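(* Let $(G_m)_{m\in\mathbb{Z}}$ be a generalized Fibonacci sequence and let $n\ge 0$ be an integer. Then $$\begin{aligned} \sum_{k=0}^n (-1)^k k\, G_k G_{n-k} = {}& (-1)^{n+1} \frac{1}{2} n \left( G_{-1} G_n - G_0 G_{n+1} \right) \\ & + \frac{1}{4} \left(1-(-1)^n\right) \left[ G_2 G_n - (G_{-1}+G_1) G_{n+1} \right]. \end{aligned}$$
   Context: A generalized Fibonacci sequence is a sequence $(G_m)_{m\in\mathbb{Z}}$ of complex numbers with $G_{m+2}=G_{m+1}+G_m$ for all integers $m$ (with arbitrary seed $G_0,G_1$); in particular $G_{-1}=G_1-G_0$. *)

theory Defs
  imports Complex_Main
begin

definition generalized_fibonacci :: "(int \<Rightarrow> complex) \<Rightarrow> bool" where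
  "generalized_fibonacci G \<longleftrightarrow> (\<forall>m. G (m + 2) = G (m + 1) + G m)"

end

(* The summand (-1)^k k G_k H_{m-k} has an antidifference (-1)^k (k A_k + B_k) with A, B bilinear in
   (G_k, G_{k+1}) and (H_{m-k}, H_{m-k-1}), because the ratios occurring in (-1)^k G_k H_{m-k},
   namely -1 and the squares of the two roots of x^2 = x + 1, all differ from 1.
   Comparing coefficients gives A and B, and the theorem is the case H = G, m = n. *)
theory Submission
  imports Defs
begin

lemma generalized_fibonacciD:
  assumes "generalized_fibonacci G" "c = a + 2" "b = a + 1"
  shows "G c = G b + G a"
  using assms by (simp add: generalized_fibonacci_def)

text \<open>Keeping \<open>m\<close> separate from the upper limit \<open>N\<close> leaves the
  summands fixed during induction on \<open>N\<close>; in the target sum both vary with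
  \<open>n\<close>. The factor 4 clears the denominators of the antidifference.\<close>

lemma alternating_weighted_convolution_partial:
  fixes G H :: "int \<Rightarrow> complex" and m :: int and N :: nat
  assumes G: "generalized_fibonacci G" and H: "generalized_fibonacci H"
  defines "A \<equiv> \<lambda>k. 2 * (G (k + 1) * H (m - k) - G k * H (m - k - 1))"
    and "B \<equiv> \<lambda>k. - 2 * G k * H (m - k) - G k * H (m - k - 1)
                  + G (k + 1) * H (m - k) + 2 * G (k + 1) * H (m - k - 1)"
  shows "4 * (\<Sum>k=0..N. (-1) ^ k * of_nat k * G (int k) * H (m - int k)) =
    (-1) ^ N * (of_nat N * A (int N) + B (int N)) - B 0"
proof (induction N)
  case 0
  show ?case by simp
next
  case (Suc N)
  \<comment> \<open>Two adjacent values of each sequence determine all others, so these four serve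
    as coordinates at both \<open>N\<close> and \<open>Suc N\<close>.\<close>
  define x y u v where "x = G (int N)" and "y = G (int N + 1)"
    and "u = H (m - int N - 1)" and "v = H (m - int N - 2)"
  have next_values: "G (int N + 2) = y + x" "H (m - int N) = u + v"
    unfolding x_def y_def u_def v_def
    by (rule generalized_fibonacciD[OF G] generalized_fibonacciD[OF H]; simp)+
  have AB: "A (int N) = 2 * (y * (u + v) - x * u)"
    "A (int (Suc N)) = 2 * ((y + x) * u - y * v)"
    "B (int N) = - 2 * x * (u + v) - x * u + y * (u + v) + 2 * y * u"
    "B (int (Suc N)) = - 2 * y * u - y * v + (y + x) * u + 2 * (y + x) * v"
    unfolding A_def B_def using next_values
    by (simp_all add: x_def y_def u_def v_def algebra_simps)
  have summand: "G (int (Suc N)) * H (m - int (Suc N)) = y * u"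
    by (simp add: y_def u_def algebra_simps)
  define e t :: complex where "e = (-1) ^ N" and "t = of_nat N"
  have "4 * (\<Sum>k=0..Suc N. (-1) ^ k * of_nat k * G (int k) * H (m - int k)) =
    e * (t * A (int N) + B (int N)) - B 0 - 4 * e * (t + 1) * (y * u)"
    using Suc.IH unfolding e_def t_def summand[symmetric] by (simp add: algebra_simps)
  \<comment> \<open>Comparing powers of \<open>t\<close>, this amounts to A_N + A_{N+1} = 4 y u and
    B_N + B_{N+1} = A_N.\<close>
  also have "\<dots> = - e * ((t + 1) * A (int (Suc N)) + B (int (Suc N))) - B 0"
    unfolding AB by algebra
  finally show ?case
    by (simp add: e_def t_def add.commute)
qed

theorem mainTheorem13:
  fixes G :: "int \<Rightarrow> complex" and n :: nat
  assumes "generalized_fibonacci G"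
  shows "(\<Sum>k=0..n. (-1) ^ k * of_nat k * G (int k) * G (int n - int k)) =
    (-1) ^ (n + 1) * (1 / 2) * of_nat n * (G (-1) * G (int n) - G 0 * G (int n + 1))
    + (1 / 4) * (1 - (-1) ^ n) * (G 2 * G (int n) - (G (-1) + G 1) * G (int n + 1))"
proof -
  have seeds: "G 2 = G 1 + G 0" "G 1 = G 0 + G (-1)" "G (int n + 1) = G (int n) + G (int n - 1)"
    by (rule generalized_fibonacciD[OF assms]; simp)+
  define S where "S = (\<Sum>k=0..n. (-1) ^ k * of_nat k * G (int k) * G (int n - int k))"
  define e t :: complex where "e = (-1) ^ n" and "t = of_nat n"
  have "4 * S = e * (t * (2 * (G (int n + 1) * G 0 - G (int n) * G (-1)))
      + (- 2 * G (int n) * G 0 - G (int n) * G (-1) + G (int n + 1) * G 0 + 2 * G (int n + 1) * G (-1)))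
    - (- 2 * G 0 * G (int n) - G 0 * G (int n - 1) + G 1 * G (int n) + 2 * G 1 * G (int n - 1))"
    unfolding S_def e_def t_def alternating_weighted_convolution_partial[OF assms assms] by simp
  \<comment> \<open>In terms of G_0, G_{-1}, G_n and G_{n-1}, the boundary values B_n and B_0
    coincide when both sequences are \<open>G\<close>. They combine to (e - 1) B_0, which yields the
    factor \<open>1 - e\<close>.\<close>
  also have "\<dots> = 4 * (- e * (1 / 2) * t * (G (-1) * G (int n) - G 0 * G (int n + 1))
    + (1 / 4) * (1 - e) * (G 2 * G (int n) - (G (-1) + G 1) * G (int n + 1)))"
    unfolding seeds by (simp add: algebra_simps add_divide_distrib diff_divide_distrib)
  finally have "S = - e * (1 / 2) * t * (G (-1) * G (int n) - G 0 * G (int n + 1))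
    + (1 / 4) * (1 - e) * (G 2 * G (int n) - (G (-1) + G 1) * G (int n + 1))"
    by (subst (asm) mult_cancel_left) simp
  then show ?thesis
    by (simp add: S_def e_def t_def)
qed

end
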